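(* Let the positive integer $n$ have the prime-power decomposition $n=\prod_{i=1}^r p_i^{e_i}$, with $p_1,\dots,p_r$ distinct primes and $e_i\ge 1$. Then $$\mathrm{Aut}(\mathbb{Z}/n\mathbb{Z},\cdot)\cong\prod_{i=1}^r\mathrm{Aut}(\mathbb{Z}/p_i^{e_i}\mathbb{Z},\cdot)$$ as groups.
   Context: For a ring $R$, $(R,\cdot)$ denotes its multiplicative monoid and $\mathrm{Aut}(R,\cdot)$ the group of monoid automorphisms of $(R,\cdot)$ (not assumed to preserve addition). *)

theory Defs
  imports
    "HOL-Algebra.IntRing"
    "HOL-Algebra.Bij"
    "HOL-Algebra.Product_Groups"
begin

text \<open>
  Only the fields \<^const>\<open>carrier\<close>, \<^const>\<open>monoid.mult\<close> and \<^const>\<open>one\<close> of \<open>M\<close> are used. Since ring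
  records extend monoid records, for a ring \<open>R\<close> the term \<open>monoid_aut_group R\<close> is the group of
  automorphisms of the multiplicative monoid of \<open>R\<close>; the additive structure plays no role.
  As for \<^const>\<open>AutoGroup\<close>, automorphisms are extensional functions on the carrier, and the
  operation is composition.
\<close>

definition monoid_auto :: "('a, 'm) monoid_scheme \<Rightarrow> ('a \<Rightarrow> 'a) set"
  where "monoid_auto M = {f \<in> hom M M \<inter> Bij (carrier M). f \<one>\<^bsub>M\<^esub> = \<one>\<^bsub>M\<^esub>}"

definition monoid_aut_group :: "('a, 'm) monoid_scheme \<Rightarrow> ('a \<Rightarrow> 'a) monoid"
  where "monoid_aut_group M = BijGroup (carrier M)\<lparr>carrier := monoid_auto M\<rparr>"

lemma (in monoid) monoid_auto_eq_auto: "monoid_auto G = auto G"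
proof -
  have "f \<one> = \<one>" if f: "f \<in> hom G G" "f \<in> Bij (carrier G)" for f
  proof -
    have im: "f ` carrier G = carrier G"
      using f(2) by (simp add: Bij_def bij_betw_def)
    then obtain x where x: "x \<in> carrier G" "f x = \<one>"
      by (metis imageE one_closed)
    have "f \<one> \<in> carrier G"
      using im by blast
    then have "f \<one> = f x \<otimes> f \<one>"
      using x by simp
    also have "\<dots> = f (x \<otimes> \<one>)"
      using f(1) x(1) by (metis hom_mult one_closed)
    also have "\<dots> = \<one>"
      using x by simp
    finally show ?thesis .
  qed
  then show ?thesis
    by (auto simp: monoid_auto_def auto_def)
qed

lemma (in monoid) monoid_aut_group_eq_AutoGroup: "monoid_aut_group G = AutoGroup G"
  by (simp add: monoid_aut_group_def AutoGroup_def monoid_auto_eq_auto)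

lemma (in monoid) group_monoid_aut_group: "group (monoid_aut_group G)"
proof -
  have "subgroup (auto G) (BijGroup (carrier G))"
  proof (rule subgroup.intro)
    show "auto G \<subseteq> carrier (BijGroup (carrier G))"
      by (force simp add: auto_def BijGroup_def)
  next
    fix x y
    assume "x \<in> auto G" "y \<in> auto G"
    then show "x \<otimes>\<^bsub>BijGroup (carrier G)\<^esub> y \<in> auto G"
      by (simp add: BijGroup_def auto_def compose_Bij)
        (simp add: hom_def compose_def Pi_iff)
  next
    show "\<one>\<^bsub>BijGroup (carrier G)\<^esub> \<in> auto G"
      by (simp add: BijGroup_def auto_def hom_def id_Bij)
  next
    fix x
    assume "x \<in> auto G"
    then show "inv\<^bsub>BijGroup (carrier G)\<^esub> x \<in> auto G"
      by (auto simp del: restrict_apply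
          simp: inv_BijGroup auto_def restrict_inv_into_Bij)
        (simp add: hom_def Bij_inv_into_mem Bij_inv_into_lemma Pi_iff)
  qed
  then show ?thesis
    by (simp add: monoid_aut_group_eq_AutoGroup AutoGroup_def subgroup.subgroup_is_group
        group_BijGroup)
qed

end

theory Submission
  imports Defs "HOL-Number_Theory.Cong"
begin

text \<open>
  By the Chinese remainder theorem the multiplicative monoid \<open>M\<close> of \<open>\<int>/n\<int>\<close> is the product of the
  monoids \<open>M\<^sub>i\<close> of \<open>\<int>/q\<^sub>i\<int>\<close>, \<open>q\<^sub>i\<close> the prime powers of \<open>n\<close>. Each \<open>M\<^sub>i\<close> has only the idempotents \<open>0\<close> and \<open>1\<close>, so an idempotent \<open>u\<close>
  of \<open>M\<close> is the indicator of a set \<open>S\<close> of indices, and \<open>u M\<close> has \<open>\<Prod>\<^bsub>i \<in> S\<^esub> q\<^sub>i\<close> elements. By unique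
  factorization this cardinality determines \<open>S\<close>; as automorphisms preserve it, they fix the
  primitive idempotents \<open>\<epsilon>\<^sub>i\<close>. Two elements \<open>x\<close>, \<open>y\<close> have the same \<open>i\<close>-th component iff
  \<open>x \<epsilon>\<^sub>i = y \<epsilon>\<^sub>i\<close>, so every automorphism acts componentwise.
\<close>

section \<open>Monoid automorphisms and their group\<close>

lemma monoid_autoD:
  assumes "f \<in> monoid_auto M"
  shows "f \<in> hom M M" "bij_betw f (carrier M) (carrier M)" "f \<in> extensional (carrier M)"
    "f \<one>\<^bsub>M\<^esub> = \<one>\<^bsub>M\<^esub>"
  using assms by (auto simp: monoid_auto_def Bij_def)

lemma carrier_monoid_aut_group [simp]: "carrier (monoid_aut_group M) = monoid_auto M"
  by (simp add: monoid_aut_group_def)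

text \<open>The membership hypotheses matter: the operation of \<open>BijGroup\<close> is a function
  restricted to \<open>Bij\<close>.\<close>

lemma mult_monoid_aut_group:
  assumes "f \<in> monoid_auto M" "g \<in> monoid_auto M"
  shows "f \<otimes>\<^bsub>monoid_aut_group M\<^esub> g = compose (carrier M) f g"
  using assms by (simp add: monoid_aut_group_def BijGroup_def monoid_auto_def)

lemma (in monoid) compose_monoid_auto:
  assumes "f \<in> monoid_auto G" "g \<in> monoid_auto G"
  shows "compose (carrier G) f g \<in> monoid_auto G"
  using group.is_monoid[OF group_monoid_aut_group] assms
  by (metis carrier_monoid_aut_group monoid.m_closed mult_monoid_aut_group)

lemma (in monoid) monoid_auto_inverse:
  assumes "f \<in> monoid_auto G"
  obtains g where "g \<in> monoid_auto G" "\<And>x. x \<in> carrier G \<Longrightarrow> g (f x) = x"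
proof
  interpret A: group "monoid_aut_group G"
    by (rule group_monoid_aut_group)
  let ?g = "inv\<^bsub>monoid_aut_group G\<^esub> f"
  show g: "?g \<in> monoid_auto G"
    using A.inv_closed assms by simp
  fix x assume x: "x \<in> carrier G"
  have "compose (carrier G) ?g f = \<one>\<^bsub>monoid_aut_group G\<^esub>"
    using A.l_inv assms g mult_monoid_aut_group by fastforce
  then have "compose (carrier G) ?g f x = x"
    using x by (simp add: monoid_aut_group_def BijGroup_def)
  then show "?g (f x) = x"
    using x by (simp add: compose_def)
qed

section \<open>Automorphisms of a product of monoids\<close>

text \<open>The product is presented by projections instead of tuples, so that a residue ring with
  its reduction maps is an instance. Unit preservation is assumed separately because
  \<open>hom\<close> only asks for compatibility with multiplication.\<close>

locale monoid_product =
  fixes M :: "('a, 'm) monoid_scheme" and I :: "'i set"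
    and N :: "'i \<Rightarrow> ('b, 'n) monoid_scheme" and \<pi> :: "'i \<Rightarrow> 'a \<Rightarrow> 'b"
  assumes monoid_M: "monoid M"
    and monoid_N: "\<And>i. i \<in> I \<Longrightarrow> monoid (N i)"
    and proj_hom: "\<And>i. i \<in> I \<Longrightarrow> \<pi> i \<in> hom M (N i)"
    and proj_one: "\<And>i. i \<in> I \<Longrightarrow> \<pi> i \<one>\<^bsub>M\<^esub> = \<one>\<^bsub>N i\<^esub>"
    and proj_bij: "bij_betw (\<lambda>x. \<lambda>i\<in>I. \<pi> i x) (carrier M) (\<Pi>\<^sub>E i\<in>I. carrier (N i))"
begin

sublocale M: monoid M
  by (rule monoid_M)

lemma proj_closed [simp]: "i \<in> I \<Longrightarrow> x \<in> carrier M \<Longrightarrow> \<pi> i x \<in> carrier (N i)"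
  using proj_hom by (auto simp: hom_def)

lemma proj_mult [simp]:
  "i \<in> I \<Longrightarrow> x \<in> carrier M \<Longrightarrow> y \<in> carrier M \<Longrightarrow> \<pi> i (x \<otimes>\<^bsub>M\<^esub> y) = \<pi> i x \<otimes>\<^bsub>N i\<^esub> \<pi> i y"
  using proj_hom by (auto simp: hom_def)

lemma eq_if_proj_eq:
  assumes "x \<in> carrier M" "y \<in> carrier M" "\<And>i. i \<in> I \<Longrightarrow> \<pi> i x = \<pi> i y"
  shows "x = y"
proof -
  have "(\<lambda>i\<in>I. \<pi> i x) = (\<lambda>i\<in>I. \<pi> i y)"
    using assms(3) by (rule restrict_ext)
  then show ?thesis
    using proj_bij assms(1,2) by (auto simp: bij_betw_def dest: inj_onD)
qed

lemma proj_family: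
  assumes "\<And>i. i \<in> I \<Longrightarrow> y i \<in> carrier (N i)"
  obtains x where "x \<in> carrier M" "\<And>i. i \<in> I \<Longrightarrow> \<pi> i x = y i"
proof -
  have "restrict y I \<in> (\<lambda>x. \<lambda>i\<in>I. \<pi> i x) ` carrier M"
    using proj_bij assms by (auto simp: bij_betw_def)
  then obtain x where x: "x \<in> carrier M" "restrict y I = (\<lambda>i\<in>I. \<pi> i x)"
    by blast
  have "\<pi> i x = y i" if "i \<in> I" for i
    using fun_cong[OF x(2), of i] that by simp
  with x(1) show thesis
    by (rule that)
qed

lemma proj_surj: "i \<in> I \<Longrightarrow> \<pi> i ` carrier M = carrier (N i)"
proof (intro equalityI subsetI)
  fix y assume i: "i \<in> I" and y: "y \<in> carrier (N i)"
  \<comment> \<open>Units serve as default values in the other coordinates.\<close>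
  obtain x where "x \<in> carrier M" "\<And>j. j \<in> I \<Longrightarrow> \<pi> j x = (if j = i then y else \<one>\<^bsub>N j\<^esub>)"
    by (rule proj_family[of "\<lambda>j. if j = i then y else \<one>\<^bsub>N j\<^esub>"])
      (use y monoid_N monoid.one_closed in auto)
  then show "y \<in> \<pi> i ` carrier M"
    using i by (metis imageI)
qed auto

text \<open>The preimage under \<open>\<pi> i\<close> is chosen arbitrarily, so this is meaningful
  only when the choice does not matter. The restrictions provide the extensionality that
  \<open>product_group\<close> and \<open>monoid_auto\<close> demand.\<close>

definition component :: "('a \<Rightarrow> 'a) \<Rightarrow> 'i \<Rightarrow> 'b \<Rightarrow> 'b" where
  "component f = (\<lambda>i\<in>I. \<lambda>y\<in>carrier (N i). \<pi> i (f (inv_into (carrier M) (\<pi> i) y)))"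

text \<open>The condition under which \<open>component f i\<close> does not depend on the chosen
  preimage.\<close>

definition acts_componentwise :: "('a \<Rightarrow> 'a) \<Rightarrow> bool" where
  "acts_componentwise f \<longleftrightarrow>
    (\<forall>i\<in>I. \<forall>x\<in>carrier M. \<forall>y\<in>carrier M. \<pi> i x = \<pi> i y \<longrightarrow> \<pi> i (f x) = \<pi> i (f y))"

lemma component_proj:
  assumes "acts_componentwise f" "i \<in> I" "x \<in> carrier M"
  shows "component f i (\<pi> i x) = \<pi> i (f x)"
proof -
  let ?y = "inv_into (carrier M) (\<pi> i) (\<pi> i x)"
  have "?y \<in> carrier M" "\<pi> i ?y = \<pi> i x"
    using assms by (auto intro: inv_into_into f_inv_into_f)
  then have "\<pi> i (f ?y) = \<pi> i (f x)"
    using assms unfolding acts_componentwise_def by blast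
  then show ?thesis
    using assms by (simp add: component_def)
qed

text \<open>The hypothesis covers all automorphisms because the inverse \<open>g\<close> of
  \<open>f\<close> needs components too: \<open>component g i\<close> is a left inverse of
  \<open>component f i\<close>, which gives injectivity. Multiplicativity and surjectivity are
  transported along the surjection \<open>\<pi> i\<close>.\<close>

lemma component_auto:
  assumes "\<And>f. f \<in> monoid_auto M \<Longrightarrow> acts_componentwise f"
    and f: "f \<in> monoid_auto M" and i: "i \<in> I"
  shows "component f i \<in> monoid_auto (N i)"
proof -
  note fD = monoid_autoD[OF f]
  have fc: "f x \<in> carrier M" if "x \<in> carrier M" for x
    using fD(1) that by (auto simp: hom_def)
  obtain g where g: "g \<in> monoid_auto M" "\<And>x. x \<in> carrier M \<Longrightarrow> g (f x) = x"
    using M.monoid_auto_inverse[OF f] by blast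
  have comp: "component f i (\<pi> i x) = \<pi> i (f x)" "component g i (\<pi> i x) = \<pi> i (g x)"
    if "x \<in> carrier M" for x
    using component_proj assms(1) f g(1) i that by auto
  have surjE: "\<exists>x\<in>carrier M. y = \<pi> i x" if "y \<in> carrier (N i)" for y
    using proj_surj[OF i] that by auto
  have "component f i \<in> hom (N i) (N i)"
  proof (rule homI)
    fix y z assume "y \<in> carrier (N i)" "z \<in> carrier (N i)"
    then obtain a b where ab: "a \<in> carrier M" "b \<in> carrier M" "y = \<pi> i a" "z = \<pi> i b"
      using surjE by blast
    show "component f i y \<in> carrier (N i)"
      using ab comp fc i by simp
    have "component f i (y \<otimes>\<^bsub>N i\<^esub> z) = \<pi> i (f (a \<otimes>\<^bsub>M\<^esub> b))"
      using ab comp(1)[of "a \<otimes>\<^bsub>M\<^esub> b"] i by simp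
    also have "\<dots> = component f i y \<otimes>\<^bsub>N i\<^esub> component f i z"
      using ab comp fc i hom_mult[OF fD(1)] by simp
    finally show "component f i (y \<otimes>\<^bsub>N i\<^esub> z) = component f i y \<otimes>\<^bsub>N i\<^esub> component f i z" .
  qed
  moreover have "bij_betw (component f i) (carrier (N i)) (carrier (N i))"
    unfolding bij_betw_def
  proof
    have "component g i (component f i y) = y" if "y \<in> carrier (N i)" for y
      using surjE[OF that] comp fc g(2) by auto
    then show "inj_on (component f i) (carrier (N i))"
      by (rule inj_on_inverseI)
    have "component f i ` carrier (N i) = component f i ` \<pi> i ` carrier M"
      by (simp add: proj_surj i)
    also have "\<dots> = \<pi> i ` f ` carrier M"
      unfolding image_image using comp by (intro image_cong) auto
    finally show "component f i ` carrier (N i) = carrier (N i)"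
      using fD(2) by (simp add: bij_betw_def proj_surj i)
  qed
  moreover have "component f i \<in> extensional (carrier (N i))"
    using i by (simp add: component_def)
  moreover have "component f i \<one>\<^bsub>N i\<^esub> = \<one>\<^bsub>N i\<^esub>"
    using comp(1)[of "\<one>\<^bsub>M\<^esub>"] i fD(4) by (simp add: proj_one)
  ultimately show ?thesis
    by (simp add: monoid_auto_def Bij_def)
qed

text \<open>This yields surjectivity of \<open>component\<close>. Values of \<open>f\<close> are
  assembled from their coordinates, and every equation between elements of \<open>M\<close> is
  checked after projection.\<close>

lemma auto_of_components:
  assumes g: "\<And>i. i \<in> I \<Longrightarrow> g i \<in> monoid_auto (N i)"
  obtains f where "f \<in> monoid_auto M"
    "\<And>i x. i \<in> I \<Longrightarrow> x \<in> carrier M \<Longrightarrow> \<pi> i (f x) = g i (\<pi> i x)"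
proof -
  note gD = monoid_autoD[OF g]
  have gc: "g i y \<in> carrier (N i)" if "i \<in> I" "y \<in> carrier (N i)" for i y
    using gD(1) that by (auto simp: hom_def)
  have "\<exists>x'\<in>carrier M. \<forall>i\<in>I. \<pi> i x' = g i (\<pi> i x)" if "x \<in> carrier M" for x
    using proj_family[of "\<lambda>i. g i (\<pi> i x)"] gc that proj_closed by metis
  then obtain f0 where f0: "\<And>x. x \<in> carrier M \<Longrightarrow> f0 x \<in> carrier M"
      "\<And>i x. i \<in> I \<Longrightarrow> x \<in> carrier M \<Longrightarrow> \<pi> i (f0 x) = g i (\<pi> i x)"
    by metis
  \<comment> \<open>Restriction puts the map into \<open>extensional\<close>, which
    \<open>Bij\<close> requires.\<close>
  define f where "f = restrict f0 (carrier M)"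
  have fc: "f x \<in> carrier M" if "x \<in> carrier M" for x
    using f0 that by (simp add: f_def)
  have fp: "\<pi> i (f x) = g i (\<pi> i x)" if "i \<in> I" "x \<in> carrier M" for i x
    using f0 that by (simp add: f_def)
  have "f \<in> hom M M"
  proof (rule homI)
    fix x y assume xy: "x \<in> carrier M" "y \<in> carrier M"
    show "f x \<in> carrier M" using xy fc by simp
    show "f (x \<otimes>\<^bsub>M\<^esub> y) = f x \<otimes>\<^bsub>M\<^esub> f y"
      by (rule eq_if_proj_eq) (use xy fc fp hom_mult[OF gD(1)] in auto)
  qed
  moreover have "f \<one>\<^bsub>M\<^esub> = \<one>\<^bsub>M\<^esub>"
    by (rule eq_if_proj_eq) (use fc fp gD(4) proj_one in auto)
  moreover have "bij_betw f (carrier M) (carrier M)"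
    unfolding bij_betw_def
  proof (intro conjI inj_onI equalityI subsetI)
    fix x y assume xy: "x \<in> carrier M" "y \<in> carrier M" "f x = f y"
    show "x = y"
    proof (rule eq_if_proj_eq[OF xy(1,2)])
      fix i assume i: "i \<in> I"
      have "g i (\<pi> i x) = g i (\<pi> i y)"
        using xy fp i by metis
      then show "\<pi> i x = \<pi> i y"
        using gD(2)[OF i] xy i by (auto simp: bij_betw_def dest: inj_onD)
    qed
  next
    fix y assume y: "y \<in> carrier M"
    \<comment> \<open>A preimage of \<open>y\<close> is built from preimages of its coordinates
      under the maps \<open>g i\<close>.\<close>
    have "\<exists>z\<in>carrier (N i). g i z = \<pi> i y" if i: "i \<in> I" for i
      using bij_betw_imp_surj_on[OF gD(2)[OF i]] proj_closed[OF i y] by (metis imageE)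
    then obtain z where z: "\<And>i. i \<in> I \<Longrightarrow> z i \<in> carrier (N i)" "\<And>i. i \<in> I \<Longrightarrow> g i (z i) = \<pi> i y"
      by metis
    obtain x where x: "x \<in> carrier M" "\<And>i. i \<in> I \<Longrightarrow> \<pi> i x = z i"
      using proj_family z(1) by metis
    have "f x = y"
      by (rule eq_if_proj_eq) (use x y z fc fp in auto)
    then show "y \<in> f ` carrier M"
      using x by blast
  qed (use fc in auto)
  moreover have "f \<in> extensional (carrier M)"
    by (simp add: f_def)
  ultimately have "f \<in> monoid_auto M"
    by (simp add: monoid_auto_def Bij_def)
  then show thesis
    using that fp by blast
qed

text \<open>\<open>component\<close> itself is the isomorphism. The relation
  \<open>component_proj\<close> turns statements about components into statements about projections
  of \<open>f x\<close>.\<close>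

theorem aut_group_iso_product:
  assumes act: "\<And>f. f \<in> monoid_auto M \<Longrightarrow> acts_componentwise f"
  shows "monoid_aut_group M \<cong> product_group I (\<lambda>i. monoid_aut_group (N i))"
proof (rule is_isoI, rule isoI)
  note comp = component_proj[OF act]
  have cext: "component f \<in> extensional I" for f
    by (simp add: component_def)
  have cauto: "component f i \<in> monoid_auto (N i)" if "f \<in> monoid_auto M" "i \<in> I" for f i
    using component_auto act that by blast
  have fc: "f x \<in> carrier M" if "f \<in> monoid_auto M" "x \<in> carrier M" for f x
    using monoid_autoD(1)[OF that(1)] that(2) by (auto simp: hom_def)
  \<comment> \<open>both sides are extensional, so it suffices to compare them on projected elements\<close>
  have eqI: "h i = k i" if "h i \<in> monoid_auto (N i)" "k i \<in> monoid_auto (N i)" "i \<in> I"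
    "\<And>x. x \<in> carrier M \<Longrightarrow> h i (\<pi> i x) = k i (\<pi> i x)" for h k :: "'i \<Rightarrow> 'b \<Rightarrow> 'b" and i
  proof (rule extensionalityI[of _ "carrier (N i)"])
    fix y assume "y \<in> carrier (N i)"
    then show "h i y = k i y"
      using proj_surj[OF \<open>i \<in> I\<close>] that(4) by (metis imageE)
  qed (use that monoid_autoD(3) in auto)
  show "component \<in> hom (monoid_aut_group M) (product_group I (\<lambda>i. monoid_aut_group (N i)))"
  proof (rule homI; simp)
    fix f g assume fg: "f \<in> monoid_auto M" "g \<in> monoid_auto M"
    show "component f \<in> (\<Pi>\<^sub>E i\<in>I. monoid_auto (N i))"
      using cext cauto fg by (auto simp: PiE_def)
    let ?fg = "compose (carrier M) f g"
    have fgA: "?fg \<in> monoid_auto M"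
      using M.compose_monoid_auto fg by blast
    show "component (f \<otimes>\<^bsub>monoid_aut_group M\<^esub> g)
        = (\<lambda>i\<in>I. component f i \<otimes>\<^bsub>monoid_aut_group (N i)\<^esub> component g i)"
    proof (rule extensionalityI[of _ I])
      fix i assume i: "i \<in> I"
      let ?c = "compose (carrier (N i)) (component f i) (component g i)"
      have "component ?fg i = ?c"
      \<comment> \<open>\<open>eqI\<close> compares families, so the single map \<open>?c\<close>
        enters as a constant family.\<close>
      proof (rule eqI[of "component ?fg" i "\<lambda>_. ?c"])
        show "?c \<in> monoid_auto (N i)"
          by (intro monoid.compose_monoid_auto monoid_N cauto fg i)
        fix x assume x: "x \<in> carrier M"
        show "component ?fg i (\<pi> i x) = ?c (\<pi> i x)"
          using x i fg fgA fc by (simp add: comp compose_eq)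
      qed (use i cauto fgA in auto)
      then show "component (f \<otimes>\<^bsub>monoid_aut_group M\<^esub> g) i
          = (\<lambda>i\<in>I. component f i \<otimes>\<^bsub>monoid_aut_group (N i)\<^esub> component g i) i"
        using i fg cauto by (simp add: mult_monoid_aut_group)
    qed (use cext in auto)
  qed
  show "bij_betw component (carrier (monoid_aut_group M))
      (carrier (product_group I (\<lambda>i. monoid_aut_group (N i))))"
    unfolding bij_betw_def carrier_monoid_aut_group carrier_product_group
  proof (intro conjI inj_onI equalityI subsetI)
    fix f g assume fg: "f \<in> monoid_auto M" "g \<in> monoid_auto M" "component f = component g"
    show "f = g"
    proof (rule extensionalityI[of _ "carrier M"])
      fix x assume x: "x \<in> carrier M"
      show "f x = g x"
        by (rule eq_if_proj_eq) (use x fg fc comp in metis)+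
    qed (use fg monoid_autoD(3) in auto)
  next
    fix g assume g: "g \<in> (\<Pi>\<^sub>E i\<in>I. monoid_auto (N i))"
    obtain f where f: "f \<in> monoid_auto M"
      "\<And>i x. i \<in> I \<Longrightarrow> x \<in> carrier M \<Longrightarrow> \<pi> i (f x) = g i (\<pi> i x)"
      using auto_of_components[of g] g by blast
    have "component f = g"
    proof (rule extensionalityI[of _ I])
      fix i assume i: "i \<in> I"
      show "component f i = g i"
        by (rule eqI) (use i f g cauto comp in auto)
    qed (use g cext in \<open>auto simp: PiE_def\<close>)
    then show "g \<in> component ` monoid_auto M"
      using f by blast
  qed (use cext cauto in \<open>auto simp: PiE_def\<close>)
qed

end

section \<open>Factors with trivial idempotents\<close>

text \<open>Ring structure on the factors supplies a zero, which marks the coordinates that an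
  idempotent annihilates. Pairwise coprime cardinalities above 1 let a set of indices be recovered
  from the product of its cardinalities.\<close>

locale indecomposable_product = monoid_product M I N \<pi>
  for M :: "('a, 'm) monoid_scheme" and I :: "'i set"
    and N :: "'i \<Rightarrow> ('b, 'n) ring_scheme" and \<pi> :: "'i \<Rightarrow> 'a \<Rightarrow> 'b" +
  assumes finite_I: "finite I"
    and ring_N: "\<And>i. i \<in> I \<Longrightarrow> ring (N i)"
    and finite_N: "\<And>i. i \<in> I \<Longrightarrow> finite (carrier (N i))"
    and nontrivial_N: "\<And>i. i \<in> I \<Longrightarrow> card (carrier (N i)) > 1"
    and idempotent_N: "\<And>i x. i \<in> I \<Longrightarrow> x \<in> carrier (N i) \<Longrightarrow> x \<otimes>\<^bsub>N i\<^esub> x = x \<Longrightarrow>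
      x = \<zero>\<^bsub>N i\<^esub> \<or> x = \<one>\<^bsub>N i\<^esub>"
    and coprime_N: "\<And>i j. i \<in> I \<Longrightarrow> j \<in> I \<Longrightarrow> i \<noteq> j \<Longrightarrow>
      coprime (card (carrier (N i))) (card (carrier (N j)))"
begin

text \<open>If zero equals one, the carrier collapses to a single element, against its cardinality
  above 1.\<close>

lemma zero_neq_one_N:
  assumes "i \<in> I"
  shows "\<zero>\<^bsub>N i\<^esub> \<noteq> \<one>\<^bsub>N i\<^esub>"
proof -
  interpret ring "N i" by (rule ring_N[OF assms])
  have "carrier (N i) \<noteq> {\<zero>\<^bsub>N i\<^esub>}"
    using nontrivial_N[OF assms] by force
  then show ?thesis
    using one_zeroD by metis
qed

text \<open>In coordinates, multiplication by \<open>u\<close> is the identity where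
  \<open>u\<close> has a one and constantly zero elsewhere. The multiples of \<open>u\<close> thus
  form a product of full factors and of singletons, and the latter contribute 1 to the
  count.\<close>

lemma card_idempotent_ideal:
  assumes u: "u \<in> carrier M" "u \<otimes>\<^bsub>M\<^esub> u = u"
  shows "card ((\<lambda>x. u \<otimes>\<^bsub>M\<^esub> x) ` carrier M) = (\<Prod>i\<in>{i\<in>I. \<pi> i u = \<one>\<^bsub>N i\<^esub>}. card (carrier (N i)))"
proof -
  let ?\<Phi> = "\<lambda>x. \<lambda>i\<in>I. \<pi> i x" and ?U = "(\<lambda>x. u \<otimes>\<^bsub>M\<^esub> x) ` carrier M"
  define C where "C i = (if \<pi> i u = \<one>\<^bsub>N i\<^esub> then carrier (N i) else {\<zero>\<^bsub>N i\<^esub>})" for i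
  have mult_C: "\<pi> i u \<otimes>\<^bsub>N i\<^esub> y \<in> C i" if "i \<in> I" "y \<in> carrier (N i)" for i y
  proof -
    interpret ring "N i" by (rule ring_N[OF that(1)])
    have "\<pi> i u = \<zero>\<^bsub>N i\<^esub> \<or> \<pi> i u = \<one>\<^bsub>N i\<^esub>"
      using idempotent_N[of i "\<pi> i u"] proj_mult[of i u u] that u by simp
    then show ?thesis
      using that by (auto simp: C_def)
  qed
  \<comment> \<open>As \<open>u\<close> fixes every element of \<open>C i\<close>, any family in the
    product is its own image, so all of the product is reached.\<close>
  have C_fixed: "y \<in> carrier (N i) \<and> \<pi> i u \<otimes>\<^bsub>N i\<^esub> y = y" if "i \<in> I" "y \<in> C i" for i y
  proof -
    interpret ring "N i" by (rule ring_N[OF that(1)])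
    show ?thesis
      using that u by (auto simp: C_def split: if_splits)
  qed
  have "?\<Phi> ` ?U = (\<Pi>\<^sub>E i\<in>I. C i)"
  proof (intro equalityI subsetI)
    fix y assume "y \<in> ?\<Phi> ` ?U"
    then show "y \<in> (\<Pi>\<^sub>E i\<in>I. C i)"
      using mult_C u by auto
  next
    fix y assume y: "y \<in> (\<Pi>\<^sub>E i\<in>I. C i)"
    then have yC: "\<And>i. i \<in> I \<Longrightarrow> y i \<in> C i"
      by auto
    obtain x where x: "x \<in> carrier M" "\<And>i. i \<in> I \<Longrightarrow> \<pi> i x = y i"
      using proj_family[of y] C_fixed yC by blast
    have "?\<Phi> (u \<otimes>\<^bsub>M\<^esub> x) = y"
      by (rule extensionalityI[of _ I]) (use x y yC u C_fixed in \<open>auto simp: PiE_def\<close>)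
    then show "y \<in> ?\<Phi> ` ?U"
      using x by blast
  qed
  moreover have "inj_on ?\<Phi> ?U"
    using proj_bij u by (auto simp: bij_betw_def intro: inj_on_subset)
  ultimately have "card ?U = card (\<Pi>\<^sub>E i\<in>I. C i)"
    using card_image by metis
  also have "\<dots> = (\<Prod>i\<in>I. if \<pi> i u = \<one>\<^bsub>N i\<^esub> then card (carrier (N i)) else 1)"
    unfolding card_PiE[OF finite_I] by (rule prod.cong) (auto simp: C_def)
  also have "\<dots> = (\<Prod>i\<in>{i\<in>I. \<pi> i u = \<one>\<^bsub>N i\<^esub>}. card (carrier (N i)))"
    using finite_I by (simp add: prod.inter_filter)
  finally show ?thesis .
qed

text \<open>Each \<open>j\<close> in \<open>S\<close> has its cardinality dividing that of
  \<open>N i\<close>; for \<open>j \<noteq> i\<close> coprimality would force it to be 1. The empty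
  \<open>S\<close> is out because its product is 1.\<close>

lemma card_prod_eq_factor:
  assumes i: "i \<in> I" and S: "S \<subseteq> I"
    and eq: "(\<Prod>j\<in>S. card (carrier (N j))) = card (carrier (N i))"
  shows "S = {i}"
proof -
  have "j = i" if j: "j \<in> S" for j
  proof (rule ccontr)
    assume "j \<noteq> i"
    then have "coprime (card (carrier (N j))) (card (carrier (N i)))"
      using coprime_N i j S by blast
    moreover have "card (carrier (N j)) dvd card (carrier (N i))"
      unfolding eq[symmetric] using finite_subset[OF S finite_I] j by (rule dvd_prodI)
    ultimately have "card (carrier (N j)) = 1"
      by (metis coprime_absorb_left nat_dvd_1_iff_1)
    then show False
      using nontrivial_N[of j] j S by auto
  qed
  moreover have "S \<noteq> {}"
    using eq nontrivial_N[OF i] by auto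
  ultimately show ?thesis by blast
qed

text \<open>Multiplying by \<open>\<epsilon>\<close> keeps coordinate \<open>i\<close> and erases
  all others.\<close>

lemma primitive_idempotent:
  assumes "i \<in> I"
  obtains \<epsilon> where "\<epsilon> \<in> carrier M"
    "\<And>j. j \<in> I \<Longrightarrow> \<pi> j \<epsilon> = (if j = i then \<one>\<^bsub>N j\<^esub> else \<zero>\<^bsub>N j\<^esub>)"
proof (rule proj_family[of "\<lambda>j. if j = i then \<one>\<^bsub>N j\<^esub> else \<zero>\<^bsub>N j\<^esub>"])
  show "(if j = i then \<one>\<^bsub>N j\<^esub> else \<zero>\<^bsub>N j\<^esub>) \<in> carrier (N j)" if "j \<in> I" for j
  proof -
    interpret ring "N j" by (rule ring_N[OF that])
    show ?thesis
      using one_closed zero_closed by metis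
  qed
qed (rule that)

text \<open>The core is that \<open>f \<epsilon>\<close> has a one in coordinate \<open>i\<close>:
  the equality of the products of \<open>x\<close> and \<open>y\<close> with
  \<open>\<epsilon>\<close> can then be mapped by \<open>f\<close> and read off in that
  coordinate.\<close>

lemma auto_acts_componentwise:
  assumes f: "f \<in> monoid_auto M"
  shows "acts_componentwise f"
  unfolding acts_componentwise_def
proof (intro ballI impI)
  fix i x y assume i: "i \<in> I" and xy: "x \<in> carrier M" "y \<in> carrier M" "\<pi> i x = \<pi> i y"
  note fD = monoid_autoD[OF f]
  have fc: "f z \<in> carrier M" if "z \<in> carrier M" for z
    using fD(1) that by (auto simp: hom_def)
  have fm: "f (a \<otimes>\<^bsub>M\<^esub> b) = f a \<otimes>\<^bsub>M\<^esub> f b" if "a \<in> carrier M" "b \<in> carrier M" for a b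
    using hom_mult[OF fD(1)] that .
  obtain \<epsilon> where \<epsilon>: "\<epsilon> \<in> carrier M"
    "\<And>j. j \<in> I \<Longrightarrow> \<pi> j \<epsilon> = (if j = i then \<one>\<^bsub>N j\<^esub> else \<zero>\<^bsub>N j\<^esub>)"
    by (rule primitive_idempotent[OF i]) (rule that)
  have \<epsilon>_idem: "\<epsilon> \<otimes>\<^bsub>M\<^esub> \<epsilon> = \<epsilon>"
  proof (rule eq_if_proj_eq)
    fix j assume j: "j \<in> I"
    interpret ring "N j" by (rule ring_N[OF j])
    have "\<pi> j \<epsilon> = \<zero>\<^bsub>N j\<^esub> \<or> \<pi> j \<epsilon> = \<one>\<^bsub>N j\<^esub>"
      using \<epsilon>(2)[OF j] by presburger
    then show "\<pi> j (\<epsilon> \<otimes>\<^bsub>M\<^esub> \<epsilon>) = \<pi> j \<epsilon>"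
      using j \<epsilon>(1) by auto
  qed (use \<epsilon>(1) in auto)
  \<comment> \<open>Being bijective, \<open>f\<close> carries the multiples of
    \<open>\<epsilon>\<close> bijectively onto the multiples of \<open>f \<epsilon>\<close>, so both
    sets have the same size.\<close>
  have "f ` (\<lambda>x. \<epsilon> \<otimes>\<^bsub>M\<^esub> x) ` carrier M = (\<lambda>x. f \<epsilon> \<otimes>\<^bsub>M\<^esub> x) ` f ` carrier M"
    unfolding image_image using fm \<epsilon>(1) by (intro image_cong) auto
  then have im: "f ` (\<lambda>x. \<epsilon> \<otimes>\<^bsub>M\<^esub> x) ` carrier M = (\<lambda>x. f \<epsilon> \<otimes>\<^bsub>M\<^esub> x) ` carrier M"
    using fD(2) by (simp add: bij_betw_def)
  have "inj_on f ((\<lambda>x. \<epsilon> \<otimes>\<^bsub>M\<^esub> x) ` carrier M)"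
    using fD(2) \<epsilon>(1) by (auto simp: bij_betw_def intro: inj_on_subset)
  then have "card ((\<lambda>x. f \<epsilon> \<otimes>\<^bsub>M\<^esub> x) ` carrier M) = card ((\<lambda>x. \<epsilon> \<otimes>\<^bsub>M\<^esub> x) ` carrier M)"
    using card_image im by metis
  \<comment> \<open>Zero and one differ in every factor, so the index set belonging to
    \<open>\<epsilon>\<close> is exactly \<open>{i}\<close>.\<close>
  moreover have "\<pi> j \<epsilon> = \<one>\<^bsub>N j\<^esub> \<longleftrightarrow> j = i" if "j \<in> I" for j
    using \<epsilon>(2)[OF that] zero_neq_one_N[OF that] by presburger
  then have "{j\<in>I. \<pi> j \<epsilon> = \<one>\<^bsub>N j\<^esub>} = {i}"
    using i by blast
  moreover have f\<epsilon>_idem: "f \<epsilon> \<otimes>\<^bsub>M\<^esub> f \<epsilon> = f \<epsilon>"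
    using fm \<epsilon>(1) \<epsilon>_idem by metis
  ultimately have "(\<Prod>j\<in>{j\<in>I. \<pi> j (f \<epsilon>) = \<one>\<^bsub>N j\<^esub>}. card (carrier (N j))) = card (carrier (N i))"
    by (simp add: card_idempotent_ideal \<epsilon>(1) \<epsilon>_idem fc)
  then have "{j\<in>I. \<pi> j (f \<epsilon>) = \<one>\<^bsub>N j\<^esub>} = {i}"
    by (intro card_prod_eq_factor i) auto
  then have f\<epsilon>: "\<pi> i (f \<epsilon>) = \<one>\<^bsub>N i\<^esub>"
    by blast
  \<comment> \<open>The products agree in coordinate \<open>i\<close> by assumption and are both
    zero in all others.\<close>
  have "x \<otimes>\<^bsub>M\<^esub> \<epsilon> = y \<otimes>\<^bsub>M\<^esub> \<epsilon>"
  proof (rule eq_if_proj_eq)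
    fix j assume j: "j \<in> I"
    interpret ring "N j" by (rule ring_N[OF j])
    have "\<pi> j x = \<pi> j y \<or> \<pi> j \<epsilon> = \<zero>\<^bsub>N j\<^esub>"
      using \<epsilon>(2)[OF j] xy(3) by presburger
    then show "\<pi> j (x \<otimes>\<^bsub>M\<^esub> \<epsilon>) = \<pi> j (y \<otimes>\<^bsub>M\<^esub> \<epsilon>)"
      using j \<epsilon>(1) xy(1,2) by auto
  qed (use xy \<epsilon>(1) in auto)
  then have "f x \<otimes>\<^bsub>M\<^esub> f \<epsilon> = f y \<otimes>\<^bsub>M\<^esub> f \<epsilon>"
    using fm xy \<epsilon>(1) by metis
  then have "\<pi> i (f x) \<otimes>\<^bsub>N i\<^esub> \<one>\<^bsub>N i\<^esub> = \<pi> i (f y) \<otimes>\<^bsub>N i\<^esub> \<one>\<^bsub>N i\<^esub>"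
    using proj_mult[OF i] fc xy \<epsilon>(1) f\<epsilon> by metis
  then show "\<pi> i (f x) = \<pi> i (f y)"
    using monoid.r_one[OF monoid_N[OF i]] proj_closed[OF i] fc xy by metis
qed

end

section \<open>Residue rings\<close>

lemma ideal_int_Idl: "ideal (Idl\<^bsub>\<Z>\<^esub> {k}) \<Z>"
  by (rule int.genideal_ideal) simp

lemma carrier_ZFact: "carrier (ZFact k) = range (ZMod k)"
  by (auto simp: ZFact_def FactRing_def A_RCOSETS_def' ZMod_def)

lemma mult_ZFact: "ZMod k a \<otimes>\<^bsub>ZFact k\<^esub> ZMod k b = ZMod k (a * b)"
  using ideal.rcoset_mult_add[OF ideal_int_Idl, of a b k]
  by (simp add: ZFact_def FactRing_def ZMod_def)

lemma one_ZFact: "\<one>\<^bsub>ZFact k\<^esub> = ZMod k 1"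
  by (simp add: ZFact_def FactRing_def ZMod_def)

text \<open>The zero of the quotient is the ideal itself, which is the coset of 0.\<close>

lemma zero_ZFact: "\<zero>\<^bsub>ZFact k\<^esub> = ZMod k 0"
  using int.a_coset_add_zero[of "Idl\<^bsub>\<Z>\<^esub> {k}"] by (simp add: ZFact_def FactRing_def ZMod_def)

lemma ZMod_eq_iff_cong: "ZMod k a = ZMod k b \<longleftrightarrow> [a = b] (mod k)"
  by (simp add: ZMod_eq_mod cong_def)

lemma ring_ZFact: "ring (ZFact k)"
  using ZFact_is_cring by (rule cring.axioms)

text \<open>Division with remainder picks a representative in the interval. This gives finiteness
  and, as distinct remainders have distinct classes, the cardinality.\<close>

lemma carrier_ZFact_pos:
  assumes "k > 0"
  shows "carrier (ZFact k) = ZMod k ` {0..<k}"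
proof
  show "carrier (ZFact k) \<subseteq> ZMod k ` {0..<k}"
  proof
    fix x assume "x \<in> carrier (ZFact k)"
    then obtain a where "x = ZMod k a"
      by (auto simp: carrier_ZFact)
    then show "x \<in> ZMod k ` {0..<k}"
      using assms ZMod_mod[of k a] by (intro image_eqI[of _ _ "a mod k"]) auto
  qed
qed (auto simp: carrier_ZFact)

lemma finite_ZFact: "k > 0 \<Longrightarrow> finite (carrier (ZFact k))"
  by (simp add: carrier_ZFact_pos)

lemma card_ZFact:
  assumes "k > 0"
  shows "card (carrier (ZFact k)) = nat k"
proof -
  have "inj_on (ZMod k) {0..<k}"
    by (auto simp: inj_on_def ZMod_eq_mod)
  then show ?thesis
    using assms by (simp add: carrier_ZFact_pos card_image)
qed

text \<open>\<open>p\<close> cannot divide both \<open>a\<close> and \<open>a - 1\<close>, so the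
  prime power is coprime to one factor of \<open>a * (a - 1)\<close> and must divide the
  other.\<close>

lemma idempotent_ZFact_prime_power:
  assumes p: "Factorial_Ring.prime (p::nat)" and x: "x \<in> carrier (ZFact (int (p ^ e)))"
    and idem: "x \<otimes>\<^bsub>ZFact (int (p ^ e))\<^esub> x = x"
  shows "x = \<zero>\<^bsub>ZFact (int (p ^ e))\<^esub> \<or> x = \<one>\<^bsub>ZFact (int (p ^ e))\<^esub>"
proof -
  let ?q = "int p ^ e"
  obtain a where a: "x = ZMod ?q a"
    using x by (auto simp: carrier_ZFact)
  have "[a * a = a] (mod ?q)"
    using idem by (simp add: a mult_ZFact ZMod_eq_iff_cong)
  then have dvd: "?q dvd a * (a - 1)"
    by (simp add: cong_iff_dvd_diff algebra_simps)
  have prime: "Factorial_Ring.prime (int p)"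
    using p by simp
  have "?q dvd a \<or> ?q dvd a - 1"
  proof (cases "int p dvd a")
    case True
    then have "\<not> int p dvd a - 1"
      using prime by (metis dvd_add_right_iff diff_add_cancel not_prime_unit)
    then have "coprime ?q (a - 1)"
      using prime by (simp add: prime_imp_coprime)
    then show ?thesis
      using dvd by (simp add: coprime_dvd_mult_left_iff)
  next
    case False
    then have "coprime ?q a"
      using prime by (simp add: prime_imp_coprime)
    then show ?thesis
      using dvd by (simp add: coprime_dvd_mult_right_iff)
  qed
  then show ?thesis
    by (simp add: a zero_ZFact one_ZFact ZMod_eq_iff_cong cong_iff_dvd_diff cong_0_iff)
qed

section \<open>Reduction maps and the Chinese remainder theorem\<close>

text \<open>For \<open>q\<close> dividing \<open>n\<close>, all elements of a residue class modulo \<open>n\<close> lie in the same class modulo \<open>q\<close>,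
  so \<^const>\<open>the_elem\<close> is applied to a singleton.\<close>
definition ZFact_proj :: "int \<Rightarrow> int set \<Rightarrow> int set" where
  "ZFact_proj q X = the_elem (ZMod q ` X)"

lemma ZFact_proj_ZMod:
  assumes "q dvd n"
  shows "ZFact_proj q (ZMod n a) = ZMod q a"
proof -
  have "ZMod q b = ZMod q a" if "b \<in> ZMod n a" for b
    using rcos_zfact[OF that] assms by (auto simp: ZMod_eq_iff_cong cong_iff_dvd_diff)
  \<comment> \<open>The class contains \<open>a\<close>, so its image is not empty.\<close>
  moreover have "a \<in> ZMod n a"
    by (force simp: ZMod_def a_r_coset_def r_coset_def int_Idl)
  ultimately have "ZMod q ` ZMod n a = {ZMod q a}"
    by blast
  then show ?thesis
    by (simp add: ZFact_proj_def)
qed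

text \<open>Injectivity: congruence modulo pairwise coprime numbers gives congruence modulo their
  product. Surjectivity: the system of congruences has a simultaneous solution.\<close>

lemma ZFact_chinese_remainder:
  fixes q :: "'i \<Rightarrow> nat"
  assumes fin: "finite I" and cop: "\<And>i j. i \<in> I \<Longrightarrow> j \<in> I \<Longrightarrow> i \<noteq> j \<Longrightarrow> coprime (q i) (q j)"
    and pos: "\<And>i. i \<in> I \<Longrightarrow> q i > 0" and n: "n = (\<Prod>i\<in>I. q i)"
  shows "monoid_product (ZFact (int n)) I (\<lambda>i. ZFact (int (q i))) (\<lambda>i. ZFact_proj (int (q i)))"
proof (rule monoid_product.intro)
  have dvd: "int (q i) dvd int n" if "i \<in> I" for i
    unfolding n int_dvd_int_iff using fin that by (rule dvd_prodI)
  note proj = ZFact_proj_ZMod[OF dvd]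
  show "monoid (ZFact (int n))"
    by (simp add: ring_ZFact ring.is_monoid)
  show "monoid (ZFact (int (q i)))" for i
    by (simp add: ring_ZFact ring.is_monoid)
  show "ZFact_proj (int (q i)) \<in> hom (ZFact (int n)) (ZFact (int (q i)))" if "i \<in> I" for i
    by (rule homI) (auto simp: carrier_ZFact proj[OF that] mult_ZFact)
  show "ZFact_proj (int (q i)) \<one>\<^bsub>ZFact (int n)\<^esub> = \<one>\<^bsub>ZFact (int (q i))\<^esub>" if "i \<in> I" for i
    by (simp add: one_ZFact proj[OF that])
  let ?\<Phi> = "\<lambda>x. \<lambda>i\<in>I. ZFact_proj (int (q i)) x"
  show "bij_betw ?\<Phi> (carrier (ZFact (int n))) (\<Pi>\<^sub>E i\<in>I. carrier (ZFact (int (q i))))"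
    unfolding bij_betw_def
  proof (rule conjI, rule inj_onI)
    fix x y
    assume "x \<in> carrier (ZFact (int n))" "y \<in> carrier (ZFact (int n))" and eq: "?\<Phi> x = ?\<Phi> y"
    then obtain a b where ab: "x = ZMod (int n) a" "y = ZMod (int n) b"
      by (auto simp: carrier_ZFact)
    have "[a = b] (mod int (q i))" if "i \<in> I" for i
      using fun_cong[OF eq, of i] that by (simp add: ab proj ZMod_eq_iff_cong)
    then have "[a = b] (mod (\<Prod>i\<in>I. int (q i)))"
      using cop by (intro cong_cong_prod_coprime) auto
    then show "x = y"
      by (simp add: ab ZMod_eq_iff_cong n)
  next
    show "?\<Phi> ` carrier (ZFact (int n)) = (\<Pi>\<^sub>E i\<in>I. carrier (ZFact (int (q i))))"
    proof (intro equalityI subsetI)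
      fix y assume y: "y \<in> (\<Pi>\<^sub>E i\<in>I. carrier (ZFact (int (q i))))"
      \<comment> \<open>The system is solved over the naturals, hence the nonnegative
        representatives; they exist because \<open>q i\<close> is positive.\<close>
      have "\<exists>a::nat. y i = ZMod (int (q i)) (int a)" if i: "i \<in> I" for i
      proof -
        have "y i \<in> ZMod (int (q i)) ` {0..<int (q i)}"
          using y i pos by (auto simp flip: carrier_ZFact_pos)
        then show ?thesis
          by (metis atLeastLessThan_iff imageE nonneg_int_cases)
      qed
      then obtain a :: "'i \<Rightarrow> nat" where a: "\<And>i. i \<in> I \<Longrightarrow> y i = ZMod (int (q i)) (int (a i))"
        by metis
      obtain c where c: "\<And>i. i \<in> I \<Longrightarrow> [c = a i] (mod q i)"
        using chinese_remainder_nat[of I q a] fin cop by blast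
      have "?\<Phi> (ZMod (int n) (int c)) = y"
      proof (rule extensionalityI[of _ I])
        fix i assume i: "i \<in> I"
        show "?\<Phi> (ZMod (int n) (int c)) i = y i"
          using c[OF i] i by (simp add: proj a ZMod_eq_iff_cong cong_int_iff)
      qed (use y in \<open>auto simp: PiE_def\<close>)
      then show "y \<in> ?\<Phi> ` carrier (ZFact (int n))"
        by (auto simp: carrier_ZFact)
    qed (auto simp: carrier_ZFact proj)
  qed
qed

section \<open>Residue rings modulo n and modulo its prime powers\<close>

theorem corollary4p7:
  fixes n r :: nat and p e :: "nat \<Rightarrow> nat"
  assumes "n > 0"
    and "\<And>i. i \<in> {1..r} \<Longrightarrow> Factorial_Ring.prime (p i)"
    and "inj_on p {1..r}"
    and "\<And>i. i \<in> {1..r} \<Longrightarrow> e i \<ge> 1"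
    and "n = (\<Prod>i=1..r. p i ^ e i)"
  shows "monoid_aut_group (ZFact (int n))
    \<cong> product_group {1..r} (\<lambda>i. monoid_aut_group (ZFact (int (p i ^ e i))))"
proof -
  \<comment> \<open>Here \<open>e i \<ge> 1\<close> keeps the factor from being the trivial
    ring.\<close>
  have gt1: "p i ^ e i > 1" if "i \<in> {1..r}" for i
    using assms(2,4)[OF that] by (intro one_less_power prime_gt_1_nat) auto
  \<comment> \<open>Injectivity of \<open>p\<close> makes the primes distinct, and powers of
    distinct primes are coprime.\<close>
  have cop: "coprime (p i ^ e i) (p j ^ e j)" if "i \<in> {1..r}" "j \<in> {1..r}" "i \<noteq> j" for i j
    using assms(2,3) that by (simp add: primes_coprime inj_on_eq_iff)
  have pos: "p i ^ e i > 0" if "i \<in> {1..r}" for i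
    using gt1[OF that] by linarith
  have prod: "monoid_product (ZFact (int n)) {1..r} (\<lambda>i. ZFact (int (p i ^ e i)))
      (\<lambda>i. ZFact_proj (int (p i ^ e i)))"
    by (rule ZFact_chinese_remainder[OF finite_atLeastAtMost cop pos assms(5)])
  have card: "card (carrier (ZFact (int (p i ^ e i)))) = p i ^ e i" if "i \<in> {1..r}" for i
    by (subst card_ZFact) (use pos[OF that] in \<open>simp_all only: of_nat_0_less_iff nat_int\<close>)
  interpret indecomposable_product "ZFact (int n)" "{1..r}" "\<lambda>i. ZFact (int (p i ^ e i))"
    "\<lambda>i. ZFact_proj (int (p i ^ e i))"
  proof (rule indecomposable_product.intro[OF prod],
      rule indecomposable_product_axioms.intro)
    fix i assume i: "i \<in> {1..r}"
    show "finite (carrier (ZFact (int (p i ^ e i))))"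
      using pos[OF i] by (intro finite_ZFact) (simp only: of_nat_0_less_iff)
    show "card (carrier (ZFact (int (p i ^ e i)))) > 1"
      unfolding card[OF i] by (rule gt1[OF i])
    show "x = \<zero>\<^bsub>ZFact (int (p i ^ e i))\<^esub> \<or> x = \<one>\<^bsub>ZFact (int (p i ^ e i))\<^esub>"
      if "x \<in> carrier (ZFact (int (p i ^ e i)))" "x \<otimes>\<^bsub>ZFact (int (p i ^ e i))\<^esub> x = x" for x
      using idempotent_ZFact_prime_power assms(2)[OF i] that by blast
    fix j assume j: "j \<in> {1..r}" "i \<noteq> j"
    show "coprime (card (carrier (ZFact (int (p i ^ e i))))) (card (carrier (ZFact (int (p j ^ e j)))))"
      unfolding card[OF i] card[OF j(1)] by (rule cop[OF i j])
  qed (simp_all add: ring_ZFact)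
  \<comment> \<open>Every automorphism acts componentwise, which is the hypothesis of the general
    product theorem.\<close>
  show ?thesis
    using aut_group_iso_product auto_acts_componentwise by blast
qed

end
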